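(* Let $q$ be an odd prime power, $d\ge2$, and $Q$ a nondegenerate quadratic form on $\mathbb F_q^d$. (a) Let $P\subseteq\mathbb F_q^d$ be nonempty and let $\mathcal S$ be a nonempty family of distinct $Q$-spheres. Then $I(P,\mathcal S)=|P||\mathcal S|$ if and only if, with $L=\operatorname{aff}\Phi(\mathcal S)$ (the affine span), $$P\subseteq B(L),\qquad\mathcal S\subseteq\mathcal S(L).$$ (b) Let $L\subseteq\mathbb F_q^{d+1}$ be an affine subspace with $B(L)\ne\varnothing$, and put $r=\dim L$. Then $r\le d$. Write $L=y_0+U$ with $U$ a linear subspace and $y_0=\Phi(S_Q(c_0,r_0))$. Then there are an $r$-dimensional subspace $W\le\mathbb F_q^d$, a linear functional $\beta:W\to\mathbb F_q$, and $z\in\mathbb F_q^d$ such that $\langle z,w\rangle_Q=-\beta(w)$ for all $w\in W$ and $$\mathcal S(L)=\Bigl\{S_Q\bigl(c_0+\tfrac w2,\ r_0+\beta(w)+\langle c_0,w\rangle_Q+\tfrac14Q(w)\bigr):w\in W\Bigr\},\tag{i}$$ $$B(L)=S_Q(c_0,r_0)\cap\bigl(z+W^{\perp_Q}\bigr).\tag{ii}$$ (c) Conversely, for every choice of $c_0\in\mathbb F_q^d$, $r_0\in\mathbb F_q$, a subspace $W\le\mathbb F_q^d$, a linear functional $\beta:W\to\mathbb F_q$ and $z\in\mathbb F_q^d$ with $\langle z,w\rangle_Q=-\beta(w)$ for all $w\in W$, the sphere system on the right of (i) equals $\mathcal S(L)$ for the affine subspace $L=\Phi(S_Q(c_0,r_0))+\{(w,\beta(w)):w\in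 W\}$, and it has base locus $B(L)$ equal to the right side of (ii); when that base is nonempty, any nonempty subset $P$ of it and any nonempty subset $\mathcal S$ of the sphere system satisfy $I(P,\mathcal S)=|P||\mathcal S|$. (d) The case $r=1$ is precisely a coaxal pencil.
   Context: Put $\langle x,y\rangle_Q=\frac{Q(x+y)-Q(x)-Q(y)}2$ and $W^{\perp_Q}=\{x:\langle x,w\rangle_Q=0\ \forall w\in W\}$. For $c\in\mathbb F_q^d$, $r\in\mathbb F_q$ the $Q$-sphere is $S_Q(c,r)=\{x\in\mathbb F_q^d:Q(x-c)=r\}$; spheres are parametrized by pairs $(c,r)$ and distinct spheres means distinct parameter pairs. $I(P,\mathcal S)=|\{(p,S)\in P\times\mathcal S:p\in S\}|$. The lift is $\Phi(S_Q(c,r))=(2c,r-Q(c))\in\mathbb F_q^{d+1}$. For $x\in\mathbb F_q^d$, $y=(u,a)\in\mathbb F_q^d\times\mathbb F_q$ put $\Lambda_x(y)=Q(x)-\langle x,u\rangle_Q-a$. For a (nonempty) affine subspace $L\subseteq\mathbb F_q^{d+1}$ put $\mathcal S(L)=\Phi^{-1}(L)$ and $B(L)=\{x\in\mathbb F_q^d:\Lambda_x(y)=0\ \forall y\in L\}$. A coaxal pencil is the family of $q$ spheres whose lifts are the points $(1-t)\Phi(S_0)+t\Phi(S_1)$, $t\in\mathbb F_q$, for two distinct spheres $S_0,S_1$. *)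

theory Defs
  imports "HOL-Analysis.Analysis"
begin

text \<open>
  The ambient space is \<open>'a ^ 'n\<close> for a finite field \<open>'a\<close>, with \<open>q = CARD('a)\<close> and
  \<open>d = CARD('n)\<close>. A sphere is a pair of parameters (centre, radius), not a point set, so a family
  of distinct spheres is a set of such pairs. Lifts of spheres also live in \<open>('a ^ 'n) \<times> 'a\<close>, which
  is made a vector space over \<open>'a\<close> by the following interpretation; \<open>lift.scale\<close>,
  \<open>lift.p.subspace\<close> and \<open>lift.p.dim\<close> are its scalar multiplication, subspaces and dimension.
\<close>

interpretation lift: finite_dimensional_vector_space_prod
  "(*s) :: 'a::field \<Rightarrow> 'a ^ 'n \<Rightarrow> 'a ^ 'n" "(*) :: 'a \<Rightarrow> 'a \<Rightarrow> 'a" cart_basis "{1}"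
  by unfold_locales

subsection \<open>Quadratic forms and spheres\<close>

text \<open>Linearity in the second argument suffices for bilinearity: the polar form is symmetric.\<close>

definition quadratic_form :: "('a::field ^ 'n \<Rightarrow> 'a) \<Rightarrow> bool" where
  "quadratic_form Q \<longleftrightarrow>
     (\<forall>c x. Q (c *s x) = c\<^sup>2 * Q x) \<and>
     (\<forall>x. Vector_Spaces.linear (*s) (*) (\<lambda>y. Q (x + y) - Q x - Q y))"

definition qinner :: "('a::field ^ 'n \<Rightarrow> 'a) \<Rightarrow> 'a ^ 'n \<Rightarrow> 'a ^ 'n \<Rightarrow> 'a" where
  "qinner Q x y = (Q (x + y) - Q x - Q y) / 2"

definition nondegenerate :: "('a::field ^ 'n \<Rightarrow> 'a) \<Rightarrow> bool" where
  "nondegenerate Q \<longleftrightarrow> (\<forall>x. (\<forall>y. qinner Q x y = 0) \<longrightarrow> x = 0)"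

definition qperp :: "('a::field ^ 'n \<Rightarrow> 'a) \<Rightarrow> ('a ^ 'n) set \<Rightarrow> ('a ^ 'n) set" where
  "qperp Q W = {x. \<forall>w\<in>W. qinner Q x w = 0}"

definition qsphere :: "('a::field ^ 'n \<Rightarrow> 'a) \<Rightarrow> ('a ^ 'n) \<times> 'a \<Rightarrow> ('a ^ 'n) set" where
  "qsphere Q = (\<lambda>(c, r). {x. Q (x - c) = r})"

definition incidences ::
    "('a::field ^ 'n \<Rightarrow> 'a) \<Rightarrow> ('a ^ 'n) set \<Rightarrow> (('a ^ 'n) \<times> 'a) set \<Rightarrow> nat" where
  "incidences Q P \<S> = card {(p, S). p \<in> P \<and> S \<in> \<S> \<and> p \<in> qsphere Q S}"

subsection \<open>Affine subspaces of the lifted space\<close>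

text \<open>Affine subspaces are nonempty. The library's \<open>affine\<close> is for real vector spaces only.\<close>

definition affine_subspace :: "(('a::field ^ 'n) \<times> 'a) set \<Rightarrow> bool" where
  "affine_subspace L \<longleftrightarrow> (\<exists>y U. lift.p.subspace U \<and> L = (+) y ` U)"

definition affine_span :: "(('a::field ^ 'n) \<times> 'a) set \<Rightarrow> (('a ^ 'n) \<times> 'a) set" where
  "affine_span X = affine_subspace hull X"

definition affine_dim :: "(('a::field ^ 'n) \<times> 'a) set \<Rightarrow> nat" where
  "affine_dim L = lift.p.dim {x - y | x y. x \<in> L \<and> y \<in> L}"

subsection \<open>The lift, sphere systems and base loci\<close>

definition lift_sphere :: "('a::field ^ 'n \<Rightarrow> 'a) \<Rightarrow> ('a ^ 'n) \<times> 'a \<Rightarrow> ('a ^ 'n) \<times> 'a" where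
  "lift_sphere Q = (\<lambda>(c, r). (2 *s c, r - Q c))"

definition Lam :: "('a::field ^ 'n \<Rightarrow> 'a) \<Rightarrow> 'a ^ 'n \<Rightarrow> ('a ^ 'n) \<times> 'a \<Rightarrow> 'a" where
  "Lam Q x = (\<lambda>(u, a). Q x - qinner Q x u - a)"

definition spheres_of ::
    "('a::field ^ 'n \<Rightarrow> 'a) \<Rightarrow> (('a ^ 'n) \<times> 'a) set \<Rightarrow> (('a ^ 'n) \<times> 'a) set" where
  "spheres_of Q L = lift_sphere Q -` L"

definition base_locus ::
    "('a::field ^ 'n \<Rightarrow> 'a) \<Rightarrow> (('a ^ 'n) \<times> 'a) set \<Rightarrow> ('a ^ 'n) set" where
  "base_locus Q L = {x. \<forall>y\<in>L. Lam Q x y = 0}"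

definition coaxal_pencil :: "('a::field ^ 'n \<Rightarrow> 'a) \<Rightarrow> (('a ^ 'n) \<times> 'a) set \<Rightarrow> bool" where
  "coaxal_pencil Q \<S> \<longleftrightarrow> (\<exists>S\<^sub>0 S\<^sub>1. S\<^sub>0 \<noteq> S\<^sub>1 \<and>
     \<S> = {S. \<exists>t. lift_sphere Q S =
                 lift.scale (1 - t) (lift_sphere Q S\<^sub>0) + lift.scale t (lift_sphere Q S\<^sub>1)})"

text \<open>Linear functionals on a subspace \<open>W\<close> are total functions of which only the values on \<open>W\<close>
  matter.\<close>

definition linear_functional_on :: "('a::field ^ 'n) set \<Rightarrow> ('a ^ 'n \<Rightarrow> 'a) \<Rightarrow> bool" where
  "linear_functional_on W \<beta> \<longleftrightarrow>
     (\<forall>v\<in>W. \<forall>w\<in>W. \<beta> (v + w) = \<beta> v + \<beta> w) \<and> (\<forall>c. \<forall>w\<in>W. \<beta> (c *s w) = c * \<beta> w)"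

definition sphere_system ::
    "('a::field ^ 'n \<Rightarrow> 'a) \<Rightarrow> 'a ^ 'n \<Rightarrow> 'a \<Rightarrow> ('a ^ 'n) set \<Rightarrow> ('a ^ 'n \<Rightarrow> 'a) \<Rightarrow>
     (('a ^ 'n) \<times> 'a) set" where
  "sphere_system Q c\<^sub>0 r\<^sub>0 W \<beta> =
     {(c\<^sub>0 + (1 / 2) *s w, r\<^sub>0 + \<beta> w + qinner Q c\<^sub>0 w + 1 / 4 * Q w) | w. w \<in> W}"

end

theory Submission
  imports Defs "HOL-Number_Theory.Residues"
begin

text \<open>
  A point \<open>x\<close> lies on a sphere iff the affine function \<open>Lam Q x\<close> vanishes at the lift of that sphere,
  and in characteristic other than 2 the lift is a bijection. Incidence statements about spheres thus
  become linear algebra in the lifted space.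
\<close>

section \<open>Preliminaries on characteristic, dimension and counting\<close>

text \<open>The characteristic divides the size of the field, hence is odd. If 2 vanished, it would
  also divide 2 and so be 1, forcing 1 = 0.\<close>

lemma two_neq_zero_if_odd_CARD:
  assumes "odd CARD('a::{field, finite})"
  shows "(2::'a) \<noteq> 0"
proof
  assume "(2::'a) = 0"
  then have "CHAR('a) dvd 2"
    using of_nat_eq_0_iff_char_dvd[where ?'a='a, of 2] by simp
  moreover have "odd CHAR('a)"
    using assms CHAR_dvd_CARD[where ?'a='a] dvd_trans by blast
  ultimately have "CHAR('a) = 1"
    using prime_nat_iff[of 2] two_is_prime_nat by auto
  then show False
    using of_nat_CHAR[where ?'a='a] by simp
qed

lemma affine_dim_translate:
  assumes "lift.p.subspace U"
  shows "affine_dim ((+) y ` U) = lift.p.dim U"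
proof -
  have "{a - b | a b. a \<in> (+) y ` U \<and> b \<in> (+) y ` U} = U"
  proof (intro equalityI subsetI)
    fix v assume "v \<in> U"
    then have "v = (y + v) - (y + 0)" "y + v \<in> (+) y ` U" "y + 0 \<in> (+) y ` U"
      using lift.p.subspace_0[OF assms] by auto
    then show "v \<in> {a - b | a b. a \<in> (+) y ` U \<and> b \<in> (+) y ` U}"
      by blast
  next
    fix v assume "v \<in> {a - b | a b. a \<in> (+) y ` U \<and> b \<in> (+) y ` U}"
    then obtain u u' where "u \<in> U" "u' \<in> U" "v = (y + u) - (y + u')"
      by blast
    then show "v \<in> U"
      using lift.p.subspace_diff[OF assms] by simp
  qed
  then show ?thesis
    by (simp add: affine_dim_def)
qed

text \<open>This moves dimensions of direction spaces from the lifted space to the space of points,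
  where they are bounded by \<open>CARD('n)\<close>.\<close>

lemma dim_fst_image:
  assumes "lift.p.subspace U" "inj_on fst U"
  shows "vec.dim (fst ` U) = lift.p.dim U"
proof -
  interpret fst: Vector_Spaces.linear lift.scale "(*s)" fst
    by (rule lift.linear_fst)
  interpret pair: finite_dimensional_vector_space_pair lift.scale "lift.Basis_pair" "(*s)" cart_basis
    by unfold_locales
  show ?thesis
    using pair.dim_image_eq[OF fst.linear_axioms, of U] assms(2)
    by (simp add: lift.p.span_eq_iff[THEN iffD2, OF assms(1)])
qed

text \<open>The incidences form a subset of the finite set \<open>P \<times> \<S>\<close>, so equal
  cardinality forces equality. From here on, counting is replaced by a statement about all
  pairs.\<close>

lemma incidences_eq_iff:
  fixes Q :: "'a::{field, finite} ^ 'n \<Rightarrow> 'a"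
  shows "incidences Q P \<S> = card P * card \<S> \<longleftrightarrow> (\<forall>p\<in>P. \<forall>S\<in>\<S>. p \<in> qsphere Q S)"
proof -
  let ?I = "{(p, S). p \<in> P \<and> S \<in> \<S> \<and> p \<in> qsphere Q S}"
  have "?I \<subseteq> P \<times> \<S>"
    by auto
  then have "card ?I = card (P \<times> \<S>) \<longleftrightarrow> ?I = P \<times> \<S>"
    by (intro iffI card_subset_eq[OF finite]) (assumption+, erule arg_cong)
  then show ?thesis
    by (auto simp: incidences_def card_cartesian_product)
qed

section \<open>The polar form, the lift and base loci\<close>

locale quadratic_space =
  fixes Q :: "'a::field ^ 'n \<Rightarrow> 'a"
  assumes two_neq_zero: "(2::'a) \<noteq> 0"
    and quadratic_form: "quadratic_form Q"
begin

lemma Q_scale: "Q (c *s x) = c\<^sup>2 * Q x"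
  using quadratic_form by (simp add: quadratic_form_def)

lemma linear_qinner: "Vector_Spaces.linear (*s) (*) (qinner Q x)"
proof -
  interpret Vector_Spaces.linear "(*s)" "(*)" "\<lambda>y. Q (x + y) - Q x - Q y"
    using quadratic_form by (simp add: quadratic_form_def)
  show ?thesis
    unfolding qinner_def
    by unfold_locales (simp_all only: add scale add_divide_distrib times_divide_eq_right)
qed

sublocale qinner: Vector_Spaces.linear "(*s)" "(*)" "qinner Q x" for x
  by (rule linear_qinner)

lemma qinner_commute: "qinner Q x y = qinner Q y x"
  by (simp add: qinner_def add.commute)

lemma qinner_diff_left: "qinner Q (x - y) z = qinner Q x z - qinner Q y z"
  by (metis qinner.diff qinner_commute)

lemma Q_add: "Q (x + y) = Q x + Q y + 2 * qinner Q x y"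
  by (simp only: qinner_def times_divide_eq_right nonzero_mult_div_cancel_left[OF two_neq_zero]) simp

lemma Q_diff: "Q (x - y) = Q x + Q y - 2 * qinner Q x y"
  using Q_add[of x "- y"] Q_scale[of "-1" y] by (simp add: qinner.neg)

text \<open>Expanding \<open>Q (x - c)\<close> shows that \<open>Lam Q x\<close> takes the value
  \<open>Q (x - c) - r\<close> at the lift of \<open>(c, r)\<close>.\<close>

lemma qsphere_iff_Lam: "x \<in> qsphere Q S \<longleftrightarrow> Lam Q x (lift_sphere Q S) = 0"
  by (cases S) (auto simp: qsphere_def lift_sphere_def Lam_def Q_diff qinner.scale algebra_simps)

text \<open>This isolates the linear part of the affine function \<open>Lam Q x\<close>, which is
  what has to vanish on a direction space.\<close>

lemma Lam_add: "Lam Q x (y + v) = Lam Q x y - (qinner Q x (fst v) + snd v)"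
  by (cases y, cases v) (simp add: Lam_def qinner.add)

text \<open>Comparing first coordinates gives \<open>c\<close>; expanding \<open>Q\<close> at this
  centre then gives \<open>r\<close>. The terms of \<open>sphere_system\<close> originate
  here.\<close>

lemma lift_sphere_eq_iff:
  "lift_sphere Q (c, r) = lift_sphere Q (c\<^sub>0, r\<^sub>0) + (w, b) \<longleftrightarrow>
    c = c\<^sub>0 + (1 / 2) *s w \<and> r = r\<^sub>0 + b + qinner Q c\<^sub>0 w + 1 / 4 * Q w"
proof -
  have half: "2 * (1 / 2) = (1::'a)" and four: "(1 / 2)\<^sup>2 = (1 / 4::'a)"
    using two_neq_zero by (simp_all add: power2_eq_square)
  have "2 *s c = 2 *s c\<^sub>0 + w \<longleftrightarrow> 2 *s c = 2 *s (c\<^sub>0 + (1 / 2) *s w)"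
    using half by (simp add: vec.scale_right_distrib del: times_divide_eq_right)
  then have "2 *s c = 2 *s c\<^sub>0 + w \<longleftrightarrow> c = c\<^sub>0 + (1 / 2) *s w"
    using two_neq_zero vec.scale_cancel_left[of 2] by blast
  moreover have "Q (c\<^sub>0 + (1 / 2) *s w) = Q c\<^sub>0 + qinner Q c\<^sub>0 w + 1 / 4 * Q w"
    using two_neq_zero by (simp add: Q_add Q_scale qinner.scale four)
  ultimately show ?thesis
    by (auto simp: lift_sphere_def algebra_simps)
qed

text \<open>Halving the first coordinate recovers the centre, and adding \<open>Q\<close> of that
  centre to the second recovers the radius.\<close>

lemma bij_lift_sphere: "bij (lift_sphere Q)"
proof (rule bijI)
  show "inj (lift_sphere Q)"
    using two_neq_zero by (auto simp: inj_def lift_sphere_def)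
  show "surj (lift_sphere Q)"
  proof (rule surjI)
    fix y
    show "lift_sphere Q ((1 / 2) *s fst y, snd y + Q ((1 / 2) *s fst y)) = y"
      using two_neq_zero by (simp add: lift_sphere_def)
  qed
qed

text \<open>As the lift is surjective, \<open>L\<close> is the image of its own preimage. Thus a
  sphere system determines its affine subspace.\<close>

lemma spheres_of_inject: "spheres_of Q L = spheres_of Q L' \<longleftrightarrow> L = L'"
  unfolding spheres_of_def using surj_image_vimage_eq[OF bij_is_surj[OF bij_lift_sphere]] by metis

lemma base_locus_lift_image: "base_locus Q (lift_sphere Q ` \<S>) = (\<Inter>S\<in>\<S>. qsphere Q S)"
  by (auto simp: base_locus_def qsphere_iff_Lam)

text \<open>Every point of \<open>L\<close> is the lift of some sphere, so the algebraic base locus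
  is the geometric intersection of the system.\<close>

lemma Inter_qsphere_spheres_of: "(\<Inter>S\<in>spheres_of Q L. qsphere Q S) = base_locus Q L"
  by (simp add: spheres_of_def surj_image_vimage_eq bij_is_surj bij_lift_sphere
      flip: base_locus_lift_image)

lemma base_locus_translate:
  assumes "lift.p.subspace U"
  shows "base_locus Q ((+) y ` U) =
    {x. Lam Q x y = 0 \<and> (\<forall>v\<in>U. qinner Q x (fst v) + snd v = 0)}"
proof -
  have "(\<forall>v\<in>U. Lam Q x (y + v) = 0) \<longleftrightarrow>
      Lam Q x y = 0 \<and> (\<forall>v\<in>U. qinner Q x (fst v) + snd v = 0)" (is "?l \<longleftrightarrow> ?r") for x
  proof
    assume l: ?l
    \<comment> \<open>The direction \<open>0\<close> separates the condition at \<open>y\<close>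
      from the conditions on \<open>U\<close>.\<close>
    have "Lam Q x y = 0"
      using bspec[OF l lift.p.subspace_0[OF assms]] by simp
    with l show ?r
      by (simp only: Lam_add diff_0 neg_equal_0_iff_equal simp_thms)
  qed (simp add: Lam_add)
  then show ?thesis
    by (simp add: base_locus_def)
qed

text \<open>For fixed \<open>x\<close> the zero set of \<open>\<lambda>y. Lam Q x y\<close> is itself an affine subspace.\<close>
lemma base_locus_affine_span: "base_locus Q (affine_span X) = base_locus Q X"
proof
  show "base_locus Q (affine_span X) \<subseteq> base_locus Q X"
    using hull_subset[of X affine_subspace] by (auto simp: base_locus_def affine_span_def)
  show "base_locus Q X \<subseteq> base_locus Q (affine_span X)"
  proof
    fix x assume x: "x \<in> base_locus Q X"
    let ?U = "{v. snd v = - qinner Q x (fst v)}"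
    have "{y. Lam Q x y = 0} = (+) (0, Q x) ` ?U"
    proof (intro equalityI subsetI)
      fix y assume "y \<in> {y. Lam Q x y = 0}"
      then have "y - (0, Q x) \<in> ?U"
        by (cases y) (simp add: Lam_def algebra_simps)
      then show "y \<in> (+) (0, Q x) ` ?U"
        by (rule rev_image_eqI) simp
    qed (auto simp: Lam_def algebra_simps)
    moreover have "lift.p.subspace ?U"
      unfolding lift.p.subspace_def
      by (simp add: qinner.zero qinner.add qinner.scale lift.scale_def)
    ultimately have "affine_subspace {y. Lam Q x y = 0}"
      by (auto simp: affine_subspace_def)
    moreover have "X \<subseteq> {y. Lam Q x y = 0}"
      using x by (auto simp: base_locus_def)
    ultimately have "affine_span X \<subseteq> {y. Lam Q x y = 0}"
      unfolding affine_span_def by (rule hull_minimal[rotated])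
    then show "x \<in> base_locus Q (affine_span X)"
      by (auto simp: base_locus_def)
  qed
qed

section \<open>Direction spaces that are graphs of functionals\<close>

lemma subspace_graph:
  assumes "vec.subspace W" "linear_functional_on W \<beta>"
  shows "lift.p.subspace {(w, \<beta> w) | w. w \<in> W}"
proof -
  \<comment> \<open>Homogeneity with scalar 0 applies because \<open>0\<close> lies in
    \<open>W\<close>, the only place where \<open>\<beta>\<close> is constrained.\<close>
  have "\<beta> 0 = 0"
    using assms by (metis linear_functional_on_def mult_zero_left vec.scale_zero_left vec.subspace_0)
  then show ?thesis
    using assms
    by (auto simp: lift.p.subspace_def vec.subspace_def lift.scale_def linear_functional_on_def zero_prod_def)
qed

lemma spheres_of_graph:
  "spheres_of Q ((+) (lift_sphere Q (c\<^sub>0, r\<^sub>0)) ` {(w, \<beta> w) | w. w \<in> W}) = sphere_system Q c\<^sub>0 r\<^sub>0 W \<beta>"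
  by (auto simp: spheres_of_def sphere_system_def image_def lift_sphere_eq_iff)

text \<open>The conditions along the graph say that \<open>x\<close> and \<open>z\<close> have the
  same pairing with each \<open>w\<close> in \<open>W\<close>, that is, \<open>x - z\<close> is
  orthogonal to \<open>W\<close>.\<close>

lemma base_locus_graph:
  assumes "vec.subspace W" "linear_functional_on W \<beta>" and z: "\<forall>w\<in>W. qinner Q z w = - \<beta> w"
  shows "base_locus Q ((+) (lift_sphere Q (c\<^sub>0, r\<^sub>0)) ` {(w, \<beta> w) | w. w \<in> W}) =
    qsphere Q (c\<^sub>0, r\<^sub>0) \<inter> (+) z ` qperp Q W"
proof -
  have "x \<in> (+) z ` qperp Q W \<longleftrightarrow> (\<forall>w\<in>W. qinner Q x w + \<beta> w = 0)" for x
  proof -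
    have "x \<in> (+) z ` qperp Q W \<longleftrightarrow> x - z \<in> qperp Q W"
      by (metis (no_types, opaque_lifting) add.commute diff_add_cancel image_iff add_diff_cancel_left')
    then show ?thesis
      using z by (simp add: qperp_def qinner_diff_left)
  qed
  then show ?thesis
    unfolding base_locus_translate[OF subspace_graph[OF assms(1,2)]]
    by (auto simp: qsphere_iff_Lam)
qed

text \<open>A common zero \<open>x\<close> of the \<open>Lam Q x\<close> forces the direction space to be the graph of
  \<open>w \<mapsto> - qinner Q x w\<close>, so that \<open>x\<close> itself can serve as \<open>z\<close>.\<close>
lemma base_locus_nonempty_graph:
  assumes U: "lift.p.subspace U" and x: "x \<in> base_locus Q ((+) y ` U)"
    and \<beta>_def: "\<beta> = (\<lambda>w. - qinner Q x w)"
  shows "vec.subspace (fst ` U)" "vec.dim (fst ` U) = lift.p.dim U"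
    "linear_functional_on (fst ` U) \<beta>" "U = {(w, \<beta> w) | w. w \<in> fst ` U}"
proof -
  interpret fst: Vector_Spaces.linear lift.scale "(*s)" fst
    by (rule lift.linear_fst)
  show "vec.subspace (fst ` U)"
    using U by (rule fst.subspace_image)
  have snd: "snd v = \<beta> (fst v)" if "v \<in> U" for v
    using x that unfolding base_locus_translate[OF U] \<beta>_def by (simp add: eq_neg_iff_add_eq_0 add.commute)
  then have "inj_on fst U"
    by (simp add: inj_on_def prod_eq_iff)
  with U show "vec.dim (fst ` U) = lift.p.dim U"
    by (rule dim_fst_image)
  show "linear_functional_on (fst ` U) \<beta>"
    by (auto simp: linear_functional_on_def \<beta>_def qinner.add qinner.scale)
  show "U = {(w, \<beta> w) | w. w \<in> fst ` U}"
    using snd by force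
qed

section \<open>Coaxal pencils as lines of the lifted space\<close>

lemma coaxal_pencil_iff:
  "coaxal_pencil Q \<S> \<longleftrightarrow> (\<exists>L. affine_subspace L \<and> affine_dim L = 1 \<and> \<S> = spheres_of Q L)"
proof -
  \<comment> \<open>Writing the second point as \<open>y + v\<close> turns the affine combination
    into \<open>y\<close> plus \<open>t\<close> times \<open>v\<close>, a line in base-and-direction
    form.\<close>
  have line: "{S. \<exists>t. lift_sphere Q S = lift.scale (1 - t) y + lift.scale t (y + v)} =
      spheres_of Q ((+) y ` lift.p.span {v})" for y v
    by (auto simp: spheres_of_def lift.p.span_singleton lift.p.scale_left_diff_distrib
        lift.p.scale_right_distrib)
  show ?thesis
  proof
    assume "coaxal_pencil Q \<S>"
    then obtain S\<^sub>0 S\<^sub>1 where neq: "S\<^sub>0 \<noteq> S\<^sub>1" and \<S>: "\<S> = {S. \<exists>t. lift_sphere Q S =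
        lift.scale (1 - t) (lift_sphere Q S\<^sub>0) + lift.scale t (lift_sphere Q S\<^sub>1)}"
      by (auto simp: coaxal_pencil_def)
    define v where "v = lift_sphere Q S\<^sub>1 - lift_sphere Q S\<^sub>0"
    let ?L = "(+) (lift_sphere Q S\<^sub>0) ` lift.p.span {v}"
    have "v \<noteq> 0"
      using neq bij_is_inj[OF bij_lift_sphere] by (auto simp: v_def dest: injD)
    then have "affine_dim ?L = 1"
      by (simp add: affine_dim_translate)
    moreover have "\<S> = spheres_of Q ?L"
      unfolding \<S> line[symmetric] by (simp add: v_def)
    moreover have "affine_subspace ?L"
      unfolding affine_subspace_def using lift.p.subspace_span by blast
    ultimately show "\<exists>L. affine_subspace L \<and> affine_dim L = 1 \<and> \<S> = spheres_of Q L"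
      by blast
  next
    assume "\<exists>L. affine_subspace L \<and> affine_dim L = 1 \<and> \<S> = spheres_of Q L"
    then obtain y U where U: "lift.p.subspace U" "lift.p.dim U = 1"
      and \<S>: "\<S> = spheres_of Q ((+) y ` U)"
      by (auto simp: affine_subspace_def affine_dim_translate)
    obtain B where B: "B \<subseteq> U" "lift.p.independent B" "U \<subseteq> lift.p.span B" "card B = 1"
      using lift.p.basis_exists[of U] U(2) by metis
    then obtain v where v: "B = {v}"
      by (auto simp: card_Suc_eq)
    have "v \<noteq> 0"
      using B(2) v lift.p.dependent_zero by blast
    have "U = lift.p.span {v}"
      using B v U(1) lift.p.span_minimal by blast
    \<comment> \<open>Two distinct points of the line are pulled back to spheres by surjectivity of
      the lift.\<close>
    obtain S\<^sub>0 S\<^sub>1 where S: "lift_sphere Q S\<^sub>0 = y" "lift_sphere Q S\<^sub>1 = y + v"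
      using bij_is_surj[OF bij_lift_sphere] by (metis surjD)
    then have "S\<^sub>0 \<noteq> S\<^sub>1"
      using \<open>v \<noteq> 0\<close> by auto
    then show "coaxal_pencil Q \<S>"
      unfolding coaxal_pencil_def \<S> \<open>U = lift.p.span {v}\<close> line[symmetric]
      by (intro exI[of _ S\<^sub>0] exI[of _ S\<^sub>1]) (simp only: S simp_thms)
  qed
qed

end

section \<open>Complete incidence, the shape of sphere systems and their bases, and pencils\<close>

theorem proposition2p7:
  fixes Q :: "'a::{field, finite} ^ 'n \<Rightarrow> 'a"
  assumes "odd CARD('a)" and "CARD('n) \<ge> 2"
    and "quadratic_form Q" and "nondegenerate Q"
  shows
    "(\<forall>P \<S>. P \<noteq> {} \<longrightarrow> \<S> \<noteq> {} \<longrightarrow>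
        (incidences Q P \<S> = card P * card \<S> \<longleftrightarrow>
          (let L = affine_span (lift_sphere Q ` \<S>)
           in P \<subseteq> base_locus Q L \<and> \<S> \<subseteq> spheres_of Q L)))
     \<and>
     (\<forall>L. affine_subspace L \<longrightarrow> base_locus Q L \<noteq> {} \<longrightarrow>
        affine_dim L \<le> CARD('n) \<and>
        (\<forall>U c\<^sub>0 r\<^sub>0. lift.p.subspace U \<longrightarrow> L = (+) (lift_sphere Q (c\<^sub>0, r\<^sub>0)) ` U \<longrightarrow>
          (\<exists>W \<beta> z. vec.subspace W \<and> vec.dim W = affine_dim L \<and>
             linear_functional_on W \<beta> \<and> (\<forall>w\<in>W. qinner Q z w = - \<beta> w) \<and>
             spheres_of Q L = sphere_system Q c\<^sub>0 r\<^sub>0 W \<beta> \<and>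
             base_locus Q L = qsphere Q (c\<^sub>0, r\<^sub>0) \<inter> (+) z ` qperp Q W)))
     \<and>
     (\<forall>c\<^sub>0 r\<^sub>0 W \<beta> z. vec.subspace W \<longrightarrow> linear_functional_on W \<beta> \<longrightarrow>
        (\<forall>w\<in>W. qinner Q z w = - \<beta> w) \<longrightarrow>
        (let L = (+) (lift_sphere Q (c\<^sub>0, r\<^sub>0)) ` {(w, \<beta> w) | w. w \<in> W};
             \<T> = sphere_system Q c\<^sub>0 r\<^sub>0 W \<beta>;
             B = qsphere Q (c\<^sub>0, r\<^sub>0) \<inter> (+) z ` qperp Q W
         in affine_subspace L \<and> \<T> = spheres_of Q L \<and>
            (\<Inter>S\<in>\<T>. qsphere Q S) = base_locus Q L \<and> base_locus Q L = B \<and>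
            (B \<noteq> {} \<longrightarrow>
              (\<forall>P \<S>. P \<noteq> {} \<longrightarrow> P \<subseteq> B \<longrightarrow> \<S> \<noteq> {} \<longrightarrow> \<S> \<subseteq> \<T> \<longrightarrow>
                 incidences Q P \<S> = card P * card \<S>))))
     \<and>
     (\<forall>L. affine_subspace L \<longrightarrow> (affine_dim L = 1 \<longleftrightarrow> coaxal_pencil Q (spheres_of Q L))) \<and>
     (\<forall>\<S>. coaxal_pencil Q \<S> \<longleftrightarrow>
        (\<exists>L. affine_subspace L \<and> affine_dim L = 1 \<and> \<S> = spheres_of Q L))"
proof -
  interpret quadratic_space Q
    using assms two_neq_zero_if_odd_CARD by unfold_locales auto
  show ?thesis
  proof (intro conjI allI impI)
    fix P \<S>
    \<comment> \<open>The second inclusion always holds, so the content lies in \<open>P\<close>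
      being contained in the base locus, which is unchanged by passing to the affine span.\<close>
    have "\<S> \<subseteq> spheres_of Q (affine_span (lift_sphere Q ` \<S>))"
      using hull_subset[of "lift_sphere Q ` \<S>" affine_subspace]
      by (auto simp: spheres_of_def affine_span_def)
    then show "incidences Q P \<S> = card P * card \<S> \<longleftrightarrow>
        (let L = affine_span (lift_sphere Q ` \<S>)
         in P \<subseteq> base_locus Q L \<and> \<S> \<subseteq> spheres_of Q L)"
      by (auto simp: incidences_eq_iff base_locus_affine_span base_locus_lift_image)
  next
    fix L assume "affine_subspace L" "base_locus Q L \<noteq> {}"
    then obtain x y U where U: "lift.p.subspace U" "L = (+) y ` U" and x: "x \<in> base_locus Q ((+) y ` U)"
      by (auto simp: affine_subspace_def)
    \<comment> \<open>The base point \<open>x\<close> makes \<open>fst\<close> injective on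
      \<open>U\<close>, so \<open>U\<close> has the dimension of a subspace of the point
      space.\<close>
    then have "affine_dim L = vec.dim (fst ` U)"
      by (simp add: affine_dim_translate base_locus_nonempty_graph)
    also have "\<dots> \<le> CARD('n)"
      using vec.dim_subset_UNIV[of "fst ` U"] by (simp add: vec.dimension_def card_cart_basis)
    finally show "affine_dim L \<le> CARD('n)" .
  next
    fix L U c\<^sub>0 r\<^sub>0
    assume ne: "base_locus Q L \<noteq> {}" and U: "lift.p.subspace U"
      and L: "L = (+) (lift_sphere Q (c\<^sub>0, r\<^sub>0)) ` U"
    then obtain x where x: "x \<in> base_locus Q ((+) (lift_sphere Q (c\<^sub>0, r\<^sub>0)) ` U)"
      by auto
    \<comment> \<open>Any base point \<open>x\<close> provides the witnesses: it serves as
      \<open>z\<close>, and \<open>\<beta>\<close> is the negated pairing with it.\<close>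
    define W \<beta> where "W = fst ` U" and "\<beta> = (\<lambda>w. - qinner Q x w)"
    note graph = base_locus_nonempty_graph[OF U x \<beta>_def, folded W_def]
    have z: "\<forall>w\<in>W. qinner Q x w = - \<beta> w"
      by (simp add: \<beta>_def)
    have L': "L = (+) (lift_sphere Q (c\<^sub>0, r\<^sub>0)) ` {(w, \<beta> w) | w. w \<in> W}"
      using L graph(4) by simp
    have "vec.dim W = affine_dim L"
      using U graph(2) by (simp add: L affine_dim_translate)
    moreover have "spheres_of Q L = sphere_system Q c\<^sub>0 r\<^sub>0 W \<beta>"
      unfolding L' by (rule spheres_of_graph)
    moreover have "base_locus Q L = qsphere Q (c\<^sub>0, r\<^sub>0) \<inter> (+) x ` qperp Q W"
      unfolding L' by (rule base_locus_graph[OF graph(1,3) z])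
    moreover note graph(1,3) z
    ultimately show "\<exists>W \<beta> z. vec.subspace W \<and> vec.dim W = affine_dim L \<and>
        linear_functional_on W \<beta> \<and> (\<forall>w\<in>W. qinner Q z w = - \<beta> w) \<and>
        spheres_of Q L = sphere_system Q c\<^sub>0 r\<^sub>0 W \<beta> \<and>
        base_locus Q L = qsphere Q (c\<^sub>0, r\<^sub>0) \<inter> (+) z ` qperp Q W"
      by blast
  next
    fix c\<^sub>0 r\<^sub>0 W \<beta> z
    assume W: "vec.subspace W" "linear_functional_on W \<beta>" "\<forall>w\<in>W. qinner Q z w = - \<beta> w"
    let ?L = "(+) (lift_sphere Q (c\<^sub>0, r\<^sub>0)) ` {(w, \<beta> w) | w. w \<in> W}"
    let ?T = "sphere_system Q c\<^sub>0 r\<^sub>0 W \<beta>"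
    let ?B = "qsphere Q (c\<^sub>0, r\<^sub>0) \<inter> (+) z ` qperp Q W"
    have "affine_subspace ?L"
      unfolding affine_subspace_def using subspace_graph[OF W(1,2)] by blast
    moreover have T: "?T = spheres_of Q ?L"
      by (rule spheres_of_graph[symmetric])
    moreover have Inter: "(\<Inter>S\<in>?T. qsphere Q S) = base_locus Q ?L"
      unfolding T by (rule Inter_qsphere_spheres_of)
    moreover have B: "base_locus Q ?L = ?B"
      using W by (rule base_locus_graph)
    \<comment> \<open>Each point of the base lies on all spheres of the system, so this passes to
      arbitrary subsets on both sides.\<close>
    moreover have "incidences Q P \<S> = card P * card \<S>" if "P \<subseteq> ?B" "\<S> \<subseteq> ?T" for P \<S>
      using that unfolding incidences_eq_iff B[symmetric] Inter[symmetric] by blast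
    ultimately show "let L = ?L; \<T> = ?T; B = ?B
         in affine_subspace L \<and> \<T> = spheres_of Q L \<and>
            (\<Inter>S\<in>\<T>. qsphere Q S) = base_locus Q L \<and> base_locus Q L = B \<and>
            (B \<noteq> {} \<longrightarrow>
              (\<forall>P \<S>. P \<noteq> {} \<longrightarrow> P \<subseteq> B \<longrightarrow> \<S> \<noteq> {} \<longrightarrow> \<S> \<subseteq> \<T> \<longrightarrow>
                 incidences Q P \<S> = card P * card \<S>))"
      unfolding Let_def by blast
  next
    fix L :: "(('a ^ 'n) \<times> 'a) set"
    assume "affine_subspace L"
    then show "affine_dim L = 1 \<longleftrightarrow> coaxal_pencil Q (spheres_of Q L)"
      \<comment> \<open>Injectivity of \<open>spheres_of\<close> identifies the one-dimensional
        subspace supplied by the pencil with the given \<open>L\<close>.\<close>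
      by (auto simp: coaxal_pencil_iff spheres_of_inject)
  qed (rule coaxal_pencil_iff)
qed

end
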